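(* Let $mG$ be a mixed star block graph with $k$ blocks $B_1,\dots,B_k$ of orders $n_1,\dots,n_k$. Then $$\det(mG)=\sum\det(mK_{n_i})\prod_{j=1,\,j\ne i}^k(-1)^{n_j}\left\lfloor\frac{n_j-2}{2}\right\rfloor,$$ where the sum is over all $i\in\{1,\dots,k\}$ such that $n_i$ is odd.
   Context: The directed cycle $dC_n$ has vertices $v_1,\dots,v_n$ and arcs $v_j\to v_{j+1}$ and $v_n\to v_1$. The mixed complete graph $mK_n$ ($n>3$) is obtained from $dC_n$ by adding both arcs between every pair of vertices non-adjacent in the underlying cycle. A mixed star block graph is a strongly connected digraph whose blocks $B_1,\dots,B_k$ are mixed complete graphs $B_i\cong mK_{n_i}$ and which has (at most) one cut-vertex, common to all blocks. $\det$ of a digraph is the determinant of its adjacency matrix ($(p,q)$ entry $1$ if there is an arc from vertex $p$ to vertex $q$, else $0$). *)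

theory Defs
  imports
    "Graph_Theory.Graph_Theory"
    "Jordan_Normal_Form.Determinant"
begin

definition dC :: "nat \<Rightarrow> nat pair_pre_digraph" where
  "dC n = \<lparr> pverts = {1..n}, parcs = {(j, j + 1) | j. 1 \<le> j \<and> j < n} \<union> {(n, 1)} \<rparr>"

text \<open>Only meaningful for \<open>n > 3\<close>.\<close>

definition mK :: "nat \<Rightarrow> nat pair_pre_digraph" where
  "mK n = \<lparr> pverts = pverts (dC n),
     parcs = parcs (dC n) \<union>
       {(p, q). p \<in> pverts (dC n) \<and> q \<in> pverts (dC n) \<and> p \<noteq> q \<and>
          (p, q) \<notin> parcs (dC n) \<and> (q, p) \<notin> parcs (dC n)} \<rparr>"

text \<open>
  Components, cut-vertices and blocks of a digraph refer to connectivity of the underlying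
  undirected graph, which is what the constant \<open>connected\<close> of the graph library expresses;
  the qualified name distinguishes it from topological connectedness.
\<close>

definition components :: "('a, 'b) pre_digraph \<Rightarrow> ('a, 'b) pre_digraph set" where
  "components G = {H. pre_digraph.max_subgraph G Digraph_Component.connected H}"

definition cut_vertices :: "('a, 'b) pre_digraph \<Rightarrow> 'a set" where
  "cut_vertices G =
     {v \<in> verts G. card (components G) < card (components (pre_digraph.del_vert G v))}"

definition blocks :: "('a, 'b) pre_digraph \<Rightarrow> ('a, 'b) pre_digraph set" where
  "blocks G = {B. pre_digraph.max_subgraph G
     (\<lambda>H. Digraph_Component.connected H \<and> cut_vertices H = {}) B}"

definition mixed_star_block_graph :: "('a, 'b) pre_digraph \<Rightarrow> bool" where
  "mixed_star_block_graph G \<longleftrightarrow>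
     digraph G \<and> strongly_connected G \<and>
     (\<forall>B \<in> blocks G. \<exists>n > 3. digraph_iso B (with_proj (mK n))) \<and>
     card (cut_vertices G) \<le> 1 \<and>
     (\<forall>v \<in> cut_vertices G. \<forall>B \<in> blocks G. v \<in> verts B)"

definition adjacency_matrix :: "('a, 'b) pre_digraph \<Rightarrow> 'a list \<Rightarrow> int mat" where
  "adjacency_matrix G vs = mat (length vs) (length vs)
     (\<lambda>(i, j). if vs ! i \<rightarrow>\<^bsub>G\<^esub> vs ! j then 1 else 0)"

text \<open>
  The ordering of the vertices is chosen arbitrarily; the lemma \<open>digraph_det_eq\<close> shows that
  the determinant does not depend on it.
\<close>

definition digraph_det :: "('a, 'b) pre_digraph \<Rightarrow> int" where
  "digraph_det G =
     Determinant.det (adjacency_matrix G (SOME vs. distinct vs \<and> set vs = verts G))"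

lemma det_adjacency_matrix_order:
  assumes "distinct vs" "distinct ws" "set vs = set ws"
  shows "Determinant.det (adjacency_matrix G ws) = Determinant.det (adjacency_matrix G vs)"
proof -
  let ?n = "length vs"
  have "mset ws = mset vs"
    using assms by (simp add: set_eq_iff_mset_eq_distinct)
  then obtain p where p: "p permutes {..<?n}" and ws: "permute_list p vs = ws"
    by (rule mset_eq_permutation)
  have p': "p permutes {0..<?n}"
    using p by (simp add: lessThan_atLeast0)
  have lt: "p i < ?n" if "i < ?n" for i
    using permutes_in_image[OF p] that by simp
  have len: "length ws = ?n"
    using ws by auto
  have nth: "ws ! i = vs ! p i" if "i < ?n" for i
    using ws permute_list_nth[OF p that] by simp
  define A where "A = adjacency_matrix G vs"
  have A: "A \<in> carrier_mat ?n ?n"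
    by (simp add: A_def adjacency_matrix_def)
  define R where "R = mat ?n ?n (\<lambda>(i, j). A $$ (p i, j))"
  have R: "R \<in> carrier_mat ?n ?n" "transpose_mat R \<in> carrier_mat ?n ?n"
    by (simp_all add: R_def)
  have eq: "adjacency_matrix G ws =
      transpose_mat (mat ?n ?n (\<lambda>(i, j). transpose_mat R $$ (p i, j)))"
    by (rule eq_matI) (auto simp: adjacency_matrix_def len nth lt R_def A_def)
  have "Determinant.det (adjacency_matrix G ws) =
      Determinant.det (mat ?n ?n (\<lambda>(i, j). transpose_mat R $$ (p i, j)))"
    unfolding eq by (rule det_transpose[where n = ?n]) simp
  also have "\<dots> = signof p * Determinant.det (transpose_mat R)"
    by (rule det_permute_rows[OF R(2) p'])
  also have "Determinant.det (transpose_mat R) = Determinant.det R"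
    by (rule det_transpose[OF R(1)])
  also have "Determinant.det R = signof p * Determinant.det A"
    unfolding R_def by (rule det_permute_rows[OF A p'])
  finally show ?thesis
    by (simp add: A_def sign_def)
qed

lemma digraph_det_eq:
  assumes "distinct vs" "set vs = verts G"
  shows "digraph_det G = Determinant.det (adjacency_matrix G vs)"
proof -
  have "distinct (SOME vs. distinct vs \<and> set vs = verts G) \<and>
      set (SOME vs. distinct vs \<and> set vs = verts G) = verts G"
    by (rule someI[where x = vs]) (simp add: assms)
  then show ?thesis
    unfolding digraph_det_def using assms by (intro det_adjacency_matrix_order) auto
qed

end

theory Submission
  imports Defs "HOL-Number_Theory.Cong"
begin

text \<open>
  Two blocks sharing two vertices coincide, because their union is again connected without cut
  vertices. Hence the blocks of a mixed star block graph meet pairwise only in a common vertex \<open>v\<close>,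
  and no arc joins two blocks away from \<open>v\<close>. Splitting the row of \<open>v\<close> according to the blocks makes
  the adjacency matrix block triangular, so that the determinant is the sum over the blocks of
  \<open>det B\<^sub>i\<close> times the product of \<open>det (B\<^sub>j - v)\<close> over \<open>j \<noteq> i\<close>. For \<open>B\<^sub>i \<cong> mK\<^sub>n\<close> with \<open>n\<close> even, the
  alternating vector lies in the kernel and \<open>det B\<^sub>i = 0\<close>. Removing a vertex of \<open>mK\<^sub>n\<close> leaves the
  all-ones matrix minus a bidiagonal one, whose determinant is computed by a triangular factorisation.
\<close>

section \<open>Blocks of finite digraphs\<close>

text \<open>Arcs of a well-formed digraph end in its vertex set, so a path that starts there never
  leaves it. The unrestricted closure can then be handled by plain monotonicity and
  transitivity.\<close>

lemma (in wf_digraph) connected_iff_rtrancl_symcl: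
  "Digraph_Component.connected G \<longleftrightarrow>
     verts G \<noteq> {} \<and> (\<forall>u \<in> verts G. \<forall>w \<in> verts G. (u, w) \<in> ((arcs_ends G)\<^sup>s)\<^sup>*)"
proof -
  have "(u, w) \<in> rtrancl_on (verts G) ((arcs_ends G)\<^sup>s) \<longleftrightarrow> (u, w) \<in> ((arcs_ends G)\<^sup>s)\<^sup>*"
    if "u \<in> verts G" "w \<in> verts G" for u w
  proof
    assume "(u, w) \<in> ((arcs_ends G)\<^sup>s)\<^sup>*"
    then show "(u, w) \<in> rtrancl_on (verts G) ((arcs_ends G)\<^sup>s)"
      using that by (rule rtrancl_consistent_rtrancl_on) (auto simp: symcl_def)
  qed (rule rtrancl_on_rtranclI)
  then show ?thesis
    unfolding connected_conv by auto
qed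

lemma connected_union:
  assumes "wf_digraph H" "wf_digraph K" "compatible H K"
    and "Digraph_Component.connected H" "Digraph_Component.connected K"
    and "x \<in> verts H" "x \<in> verts K"
  shows "Digraph_Component.connected (Digraph_Component.union H K)"
proof -
  interpret H: wf_digraph H by fact
  interpret K: wf_digraph K by fact
  let ?U = "Digraph_Component.union H K"
  interpret U: wf_digraph ?U
    using assms(1-3) by (rule wellformed_union)
  let ?R = "(arcs_ends ?U)\<^sup>s"
  have "arcs_ends H \<subseteq> arcs_ends ?U" "arcs_ends K \<subseteq> arcs_ends ?U"
    using assms(3) by (auto simp: union_def compatible_def arcs_ends_conv)
  then have sub: "((arcs_ends H)\<^sup>s)\<^sup>* \<subseteq> ?R\<^sup>*" "((arcs_ends K)\<^sup>s)\<^sup>* \<subseteq> ?R\<^sup>*"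
    by (auto simp: symcl_def intro!: rtrancl_mono)
  \<comment> \<open>The common vertex \<open>x\<close> serves as a hub: any two vertices of the
    union are joined through it.\<close>
  have "(u, x) \<in> ?R\<^sup>* \<and> (x, u) \<in> ?R\<^sup>*" if "u \<in> verts ?U" for u
    using that assms(4-) sub
    unfolding H.connected_iff_rtrancl_symcl K.connected_iff_rtrancl_symcl
    by (auto simp: union_def)
  then show ?thesis
    unfolding U.connected_iff_rtrancl_symcl using assms(6)
    by (auto simp: union_def intro: rtrancl_trans)
qed

lemma (in wf_digraph) connected_single_vertex:
  "verts G = {v} \<Longrightarrow> Digraph_Component.connected G"
  by (simp add: connected_iff_rtrancl_symcl)

lemma (in wf_digraph) strongly_connected_imp_connected:
  "strongly_connected G \<Longrightarrow> Digraph_Component.connected G"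
  by (auto simp: Digraph_Component.connected_def strongly_connected_def reachable_mk_symmetricI)

section \<open>Maximal subgraphs\<close>

text \<open>Compatibility fixes \<open>tail\<close> and \<open>head\<close>, so a subgraph is
  determined by its vertex set and its arc set.\<close>

lemma (in fin_digraph) finite_subgraphs: "finite {H. subgraph H G}"
proof (rule finite_subset)
  let ?f = "\<lambda>(V, A). \<lparr>verts = V, arcs = A, tail = tail G, head = head G\<rparr>"
  show "{H. subgraph H G} \<subseteq> ?f ` (Pow (verts G) \<times> Pow (arcs G))"
  proof
    fix H assume "H \<in> {H. subgraph H G}"
    then have "H = ?f (verts H, arcs H)" "(verts H, arcs H) \<in> Pow (verts G) \<times> Pow (arcs G)"
      by (auto simp: subgraph_def compatible_def)
    then show "H \<in> ?f ` (Pow (verts G) \<times> Pow (arcs G))" by (rule image_eqI)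
  qed
qed simp

lemma (in fin_digraph) extend_to_max_subgraph:
  assumes "subgraph H G" "P H"
  obtains M where "max_subgraph P M" "subgraph H M"
proof -
  let ?S = "{K. subgraph H K \<and> subgraph K G \<and> P K}"
  have fin: "finite ?S" by (rule finite_subset[OF _ finite_subgraphs]) auto
  have "H \<in> ?S"
    using assms by (auto intro: wf_digraph.subgraph_refl)
  \<comment> \<open>A subgraph of largest size among the candidates is maximal: an extension of the
    same total size has the same vertices and arcs.\<close>
  define m where "m K = card (verts K) + card (arcs K)" for K :: "('a, 'b) pre_digraph"
  have "Max (m ` ?S) \<in> m ` ?S"
    using fin \<open>H \<in> ?S\<close> by (intro Max_in) blast+
  then obtain M where M: "M \<in> ?S" and "m M = Max (m ` ?S)" by force
  then have max: "m K \<le> m M" if "K \<in> ?S" for K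
    using fin that by simp
  have "K = M" if K: "subgraph M K" "subgraph K G" "P K" for K
  proof -
    have "fin_digraph K" using K(2) by (rule fin_digraph_subgraph)
    then interpret K: fin_digraph K .
    have "K \<in> ?S" using K M subgraph_trans by blast
    then have "m K \<le> m M" by (rule max)
    moreover have sub: "verts M \<subseteq> verts K" "arcs M \<subseteq> arcs K" using K(1) by auto
    then have "card (verts M) \<le> card (verts K)" "card (arcs M) \<le> card (arcs K)"
      by (auto intro: card_mono)
    ultimately have "card (verts M) = card (verts K)" "card (arcs M) = card (arcs K)"
      by (auto simp: m_def)
    then have "verts M = verts K" "arcs M = arcs K"
      using sub by (simp_all add: card_subset_eq)
    then show ?thesis using K(1) by (auto simp: subgraph_def compatible_def)
  qed
  with M have "max_subgraph P M" by (auto simp: max_subgraph_def)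
  with M show ?thesis using that by blast
qed

text \<open>Serves both for the components of a connected digraph and for the blocks of a connected
  digraph without cut-vertices.\<close>

lemma (in wf_digraph) max_subgraph_whole:
  assumes "P G"
  shows "max_subgraph P H \<longleftrightarrow> H = G"
proof
  assume "max_subgraph P H"
  then show "H = G" using assms subgraph_refl unfolding max_subgraph_def by metis
next
  assume "H = G"
  then show "max_subgraph P H"
    using assms subgraph_refl by (auto simp: max_subgraph_def subgraph_def compatible_def)
qed

section \<open>Components and cut-vertices\<close>

lemma (in fin_digraph) card_components_connected:
  assumes "Digraph_Component.connected G"
  shows "card (components G) = 1"
proof -
  have "components G = {G}"
    using assms max_subgraph_whole by (auto simp: components_def)
  then show ?thesis by simp
qed

text \<open>Every vertex extends to a component, so a sole component is a connected spanning
  subgraph. The empty digraph has no component at all.\<close>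

lemma (in fin_digraph) card_components_le_1_iff:
  "card (components G) \<le> 1 \<longleftrightarrow> verts G = {} \<or> Digraph_Component.connected G"
proof
  assume le: "card (components G) \<le> 1"
  have fin: "finite (components G)"
    by (rule finite_subset[OF _ finite_subgraphs]) (auto simp: components_def max_subgraph_def)
  have ex: "\<exists>C \<in> components G. w \<in> verts C" if "w \<in> verts G" for w
  proof -
    let ?W = "\<lparr>verts = {w}, arcs = {}, tail = tail G, head = head G\<rparr>"
    interpret W: wf_digraph ?W by unfold_locales auto
    have "subgraph ?W G"
      using that by (auto intro!: subgraphI simp: compatible_def W.wf_digraph_axioms wf_digraph_axioms)
    then obtain C where "max_subgraph Digraph_Component.connected C" "subgraph ?W C"
      using extend_to_max_subgraph[of ?W Digraph_Component.connected] W.connected_single_vertex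
      by auto
    then show ?thesis by (auto simp: components_def subgraph_def)
  qed
  show "verts G = {} \<or> Digraph_Component.connected G"
  proof (cases "verts G = {}")
    case False
    then obtain C where C: "C \<in> components G" using ex by auto
    have "C' = C" if "C' \<in> components G" for C'
      using le fin C that by (metis card_le_Suc0_iff_eq One_nat_def)
    then have "verts G \<subseteq> verts C" using ex by blast
    moreover have "subgraph C G" "Digraph_Component.connected C"
      using C by (auto simp: components_def max_subgraph_def)
    ultimately have "spanning C G" by (auto simp: spanning_def)
    then show ?thesis
      using \<open>Digraph_Component.connected C\<close> connected_spanning_imp_connected by blast
  qed simp
next
  assume "verts G = {} \<or> Digraph_Component.connected G"
  then show "card (components G) \<le> 1"
  proof
    assume "verts G = {}"
    then have "components G = {}"
      by (auto simp: components_def max_subgraph_def connected_conv)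
    then show ?thesis by simp
  next
    assume "Digraph_Component.connected G"
    then show ?thesis by (simp add: card_components_connected)
  qed
qed

text \<open>A connected digraph has exactly one component, so \<open>v\<close> is a cut-vertex just
  when deleting it leaves at least two. The alternative \<open>verts G = {v}\<close> covers the
  deletion that leaves nothing, which has no component.\<close>

lemma (in fin_digraph) cut_vertices_empty_iff:
  assumes "Digraph_Component.connected G"
  shows "cut_vertices G = {} \<longleftrightarrow>
    (\<forall>v \<in> verts G. verts G = {v} \<or> Digraph_Component.connected (del_vert v))"
proof -
  have "\<not> card (components G) < card (components (del_vert v)) \<longleftrightarrow>
      verts G = {v} \<or> Digraph_Component.connected (del_vert v)" if "v \<in> verts G" for v
  proof -
    interpret D: fin_digraph "del_vert v" by (rule fin_digraph_del_vert)
    show ?thesis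
      using card_components_connected[OF assms] D.card_components_le_1_iff that
      by (auto simp: verts_del_vert)
  qed
  then show ?thesis by (auto simp: cut_vertices_def)
qed

section \<open>Overlaps of blocks and coverage by blocks\<close>

text \<open>Whichever vertex is deleted, \<open>x\<close> or \<open>y\<close> survives in both
  blocks and holds the remainders together. So the union is connected without cut-vertices, and
  maximality makes it equal to each block.\<close>

lemma (in fin_digraph) blocks_eq_if_share_two_vertices:
  assumes H: "H \<in> blocks G" and K: "K \<in> blocks G"
    and x: "x \<in> verts H" "x \<in> verts K" and y: "y \<in> verts H" "y \<in> verts K" and "x \<noteq> y"
  shows "H = K"
proof -
  let ?P = "\<lambda>H :: ('a, 'b) pre_digraph. Digraph_Component.connected H \<and> cut_vertices H = {}"
  have HG: "subgraph H G" "Digraph_Component.connected H" "cut_vertices H = {}"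
    and KG: "subgraph K G" "Digraph_Component.connected K" "cut_vertices K = {}"
    using H K by (auto simp: blocks_def max_subgraph_def)
  interpret H: fin_digraph H using HG(1) by (rule fin_digraph_subgraph)
  interpret K: fin_digraph K using KG(1) by (rule fin_digraph_subgraph)
  let ?U = "Digraph_Component.union H K"
  have comp: "compatible H K"
    using HG(1) KG(1) by (auto simp: subgraph_def compatible_def)
  interpret U: fin_digraph ?U
    using H.fin_digraph_axioms K.fin_digraph_axioms comp by (rule union_fin_digraph)
  have UG: "subgraph ?U G"
    using HG(1) KG(1) U.wf_digraph_axioms by (auto simp: subgraph_def union_def compatible_def)
  have HU: "subgraph H ?U" and KU: "subgraph K ?U"
    using comp H.wf_digraph_axioms K.wf_digraph_axioms U.wf_digraph_axioms
    by (auto simp: subgraph_def union_def compatible_def)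
  have conn: "Digraph_Component.connected ?U"
    using H.wf_digraph_axioms K.wf_digraph_axioms comp HG(2) KG(2) x by (rule connected_union)
  have "Digraph_Component.connected (U.del_vert v)" if "v \<in> verts ?U" for v
  proof -
    have "Digraph_Component.connected (H.del_vert v)"
    proof (cases "v \<in> verts H")
      case True
      then show ?thesis
        using HG H.cut_vertices_empty_iff x y \<open>x \<noteq> y\<close> by auto
    next
      \<comment> \<open>Deleting a vertex outside \<open>H\<close> changes nothing.\<close>
      case False
      then have "H.del_vert v = H"
        by (intro pre_digraph.equality) (auto simp: H.del_vert_def)
      then show ?thesis using HG by simp
    qed
    moreover have "Digraph_Component.connected (K.del_vert v)"
    proof (cases "v \<in> verts K")
      case True
      then show ?thesis
        using KG K.cut_vertices_empty_iff x y \<open>x \<noteq> y\<close> by auto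
    next
      case False
      then have "K.del_vert v = K"
        by (intro pre_digraph.equality) (auto simp: K.del_vert_def)
      then show ?thesis using KG by simp
    qed
    moreover have "U.del_vert v = Digraph_Component.union (H.del_vert v) (K.del_vert v)"
      using comp by (auto simp: pre_digraph.del_vert_def union_def compatible_def)
    \<comment> \<open>The witness is whichever of \<open>x\<close> and \<open>y\<close> differs from
      \<open>v\<close>.\<close>
    moreover obtain z where "z \<in> verts (H.del_vert v)" "z \<in> verts (K.del_vert v)"
      using x y \<open>x \<noteq> y\<close> unfolding pre_digraph.verts_del_vert by blast
    moreover have "compatible (H.del_vert v) (K.del_vert v)"
      using comp by (auto simp: compatible_def pre_digraph.del_vert_simps)
    ultimately show ?thesis
      using connected_union[OF H.wf_digraph_del_vert K.wf_digraph_del_vert] by metis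
  qed
  then have "?P ?U"
    using conn U.cut_vertices_empty_iff by blast
  then have "?U = H" "?U = K"
    using H K UG HU KU unfolding blocks_def max_subgraph_def by blast+
  then show ?thesis by simp
qed

lemma (in fin_digraph) extend_to_block:
  assumes "subgraph H G" "Digraph_Component.connected H" "cut_vertices H = {}"
  obtains C where "C \<in> blocks G" "subgraph H C"
  using extend_to_max_subgraph
    [of H "\<lambda>H. Digraph_Component.connected H \<and> cut_vertices H = {}"] assms
  by (auto simp: blocks_def)

lemma (in fin_digraph) vertex_in_block:
  assumes "w \<in> verts G"
  obtains C where "C \<in> blocks G" "w \<in> verts C"
proof -
  let ?W = "\<lparr>verts = {w}, arcs = {}, tail = tail G, head = head G\<rparr>"
  interpret W: fin_digraph ?W by unfold_locales auto
  have "subgraph ?W G"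
    using assms by (auto intro!: subgraphI simp: compatible_def W.wf_digraph_axioms wf_digraph_axioms)
  moreover have "Digraph_Component.connected ?W"
    by (simp add: W.connected_single_vertex)
  moreover from this have "cut_vertices ?W = {}"
    by (simp add: W.cut_vertices_empty_iff)
  ultimately obtain C where "C \<in> blocks G" "subgraph ?W C"
    by (rule extend_to_block)
  then show ?thesis using that by auto
qed

text \<open>A single arc with its two ends is connected, and deleting either end leaves one vertex;
  hence it has no cut-vertex and extends to a block.\<close>

lemma (in fin_digraph) arc_in_block:
  assumes "u \<rightarrow>\<^bsub>G\<^esub> w" "u \<noteq> w"
  obtains C where "C \<in> blocks G" "u \<rightarrow>\<^bsub>C\<^esub> w"
proof -
  from assms obtain e where e: "e \<in> arcs G" "u = tail G e" "w = head G e" by auto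
  let ?W = "\<lparr>verts = {u, w}, arcs = {e}, tail = tail G, head = head G\<rparr>"
  interpret W: fin_digraph ?W using e by unfold_locales auto
  have sub: "subgraph ?W G"
    using e by (auto intro!: subgraphI simp: compatible_def wf_digraph_axioms)
      (rule W.wf_digraph_axioms[unfolded e(2,3)])
  have "(u, w) \<in> arcs_ends ?W" using e by (auto simp: arcs_ends_conv)
  then have "(u, w) \<in> (arcs_ends ?W)\<^sup>s" "(w, u) \<in> (arcs_ends ?W)\<^sup>s"
    by (auto simp: symcl_def)
  then have conn: "Digraph_Component.connected ?W"
    by (auto simp: W.connected_iff_rtrancl_symcl)
  have "Digraph_Component.connected (W.del_vert v)" if "v \<in> verts ?W" for v
  proof -
    interpret D: wf_digraph "W.del_vert v" by (rule W.wf_digraph_del_vert)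
    have "verts (W.del_vert v) = {if v = u then w else u}"
      using that assms(2) by (auto simp: pre_digraph.verts_del_vert)
    then show ?thesis by (rule D.connected_single_vertex)
  qed
  then have "cut_vertices ?W = {}" using W.cut_vertices_empty_iff[OF conn] by blast
  with sub conn obtain C where "C \<in> blocks G" and C: "subgraph ?W C"
    by (rule extend_to_block)
  moreover have "u \<rightarrow>\<^bsub>C\<^esub> w"
    using arcs_ends_mono[OF C] \<open>(u, w) \<in> arcs_ends ?W\<close> by blast
  ultimately show ?thesis using that by blast
qed

text \<open>An arc of \<open>G\<close> between two vertices of \<open>C\<close> lies in some block,
  which shares both ends with \<open>C\<close> and therefore is \<open>C\<close>. Blocks are thus
  induced subdigraphs as far as distinct vertices are concerned.\<close>

lemma (in fin_digraph) block_dominates_iff: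
  assumes "C \<in> blocks G" "u \<in> verts C" "w \<in> verts C" "u \<noteq> w"
  shows "u \<rightarrow>\<^bsub>C\<^esub> w \<longleftrightarrow> u \<rightarrow>\<^bsub>G\<^esub> w"
proof
  have "subgraph C G" using assms(1) by (auto simp: blocks_def max_subgraph_def)
  then show "u \<rightarrow>\<^bsub>C\<^esub> w \<Longrightarrow> u \<rightarrow>\<^bsub>G\<^esub> w" using arcs_ends_mono by blast
next
  assume "u \<rightarrow>\<^bsub>G\<^esub> w"
  then obtain D where D: "D \<in> blocks G" "u \<rightarrow>\<^bsub>D\<^esub> w" using assms(4) by (rule arc_in_block)
  interpret D: wf_digraph D using D(1) by (auto simp: blocks_def max_subgraph_def)
  have "u \<in> verts D" "w \<in> verts D" using D(2) by auto
  then have "D = C" using blocks_eq_if_share_two_vertices D(1) assms by blast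
  then show "u \<rightarrow>\<^bsub>C\<^esub> w" using D by simp
qed

text \<open>Without a cut-vertex, \<open>G\<close> is its own only block and any vertex may act as
  the center; this treats a single block together with the general case.\<close>

lemma mixed_star_block_graph_center:
  assumes "mixed_star_block_graph G"
  obtains v where "v \<in> verts G" "\<And>C. C \<in> blocks G \<Longrightarrow> v \<in> verts C"
proof -
  interpret digraph G using assms by (simp add: mixed_star_block_graph_def)
  have conn: "Digraph_Component.connected G"
    using assms strongly_connected_imp_connected by (simp add: mixed_star_block_graph_def)
  show ?thesis
  proof (cases "cut_vertices G = {}")
    case True
    then have "blocks G = {G}"
      using conn max_subgraph_whole by (simp add: blocks_def)
    moreover obtain v where "v \<in> verts G"
      using conn by (auto simp: connected_iff_rtrancl_symcl)
    ultimately show ?thesis by (intro that[of v]) auto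
  next
    case False
    then obtain v where "v \<in> cut_vertices G" by auto
    then show ?thesis
      using that assms by (auto simp: mixed_star_block_graph_def cut_vertices_def)
  qed
qed

section \<open>Determinants of digraphs glued at a vertex\<close>

text \<open>A principal minor of the adjacency matrix. Keeping \<open>G\<close> fixed and varying
  the vertex set avoids constructing subdigraphs.\<close>

definition det_on :: "('a, 'b) pre_digraph \<Rightarrow> 'a set \<Rightarrow> int" where
  "det_on G S =
     Determinant.det (adjacency_matrix G (SOME vs. distinct vs \<and> set vs = S))"

lemma digraph_det_eq_det_on: "digraph_det G = det_on G (verts G)"
  by (simp add: digraph_det_def det_on_def)

lemma det_on_eq:
  assumes "distinct vs" "set vs = S"
  shows "det_on G S = Determinant.det (adjacency_matrix G vs)"
proof -
  have "distinct (SOME vs. distinct vs \<and> set vs = S) \<and> set (SOME vs. distinct vs \<and> set vs = S) = S"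
    by (rule someI[where x = vs]) (simp add: assms)
  then show ?thesis
    unfolding det_on_def using assms by (intro det_adjacency_matrix_order) auto
qed

lemma adjacency_matrix_carrier: "adjacency_matrix G vs \<in> carrier_mat (length vs) (length vs)"
  by (simp add: adjacency_matrix_def)

lemma adjacency_matrix_map_cong:
  assumes "\<And>a b. a \<in> set vs \<Longrightarrow> b \<in> set vs \<Longrightarrow> a \<rightarrow>\<^bsub>G\<^esub> b \<longleftrightarrow> f a \<rightarrow>\<^bsub>H\<^esub> f b"
  shows "adjacency_matrix G vs = adjacency_matrix H (map f vs)"
  using assms by (auto simp: adjacency_matrix_def intro!: eq_matI)

lemma det_on_image:
  assumes "finite S" "inj_on f S"
    and "\<And>a b. a \<in> S \<Longrightarrow> b \<in> S \<Longrightarrow> a \<rightarrow>\<^bsub>G\<^esub> b \<longleftrightarrow> f a \<rightarrow>\<^bsub>H\<^esub> f b"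
  shows "det_on G S = det_on H (f ` S)"
proof -
  obtain vs where vs: "distinct vs" "set vs = S"
    using finite_distinct_list[OF assms(1)] by auto
  have "det_on H (f ` S) = Determinant.det (adjacency_matrix H (map f vs))"
    using vs assms(2) by (intro det_on_eq) (auto simp: distinct_map)
  also have "adjacency_matrix H (map f vs) = adjacency_matrix G vs"
    using vs assms(3) by (intro adjacency_matrix_map_cong[symmetric]) auto
  finally show ?thesis using det_on_eq[OF vs] by simp
qed

lemma det_on_cong:
  assumes "finite S" "\<And>a b. a \<in> S \<Longrightarrow> b \<in> S \<Longrightarrow> a \<rightarrow>\<^bsub>G\<^esub> b \<longleftrightarrow> a \<rightarrow>\<^bsub>H\<^esub> b"
  shows "det_on G S = det_on H S"
  using det_on_image[of S id G H] assms by simp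

lemma det_on_empty: "det_on G {} = 1"
  using adjacency_matrix_carrier[of G "[]"] by (simp add: det_on_eq[of "[]"])

lemma det_on_single: "det_on G {v} = (if v \<rightarrow>\<^bsub>G\<^esub> v then 1 else 0)"
  using adjacency_matrix_carrier[of G "[v]"]
  by (simp add: det_on_eq[of "[v]"] det_single adjacency_matrix_def)

section \<open>Block triangular matrices and splitting of a row\<close>

text \<open>Listing \<open>S\<close> before \<open>T\<close> makes the upper right block of the
  matrix zero; arcs from \<open>T\<close> to \<open>S\<close> are unrestricted.\<close>

lemma det_on_Un:
  assumes "finite S" "finite T" "S \<inter> T = {}" "\<And>a b. a \<in> S \<Longrightarrow> b \<in> T \<Longrightarrow> \<not> a \<rightarrow>\<^bsub>G\<^esub> b"
  shows "det_on G (S \<union> T) = det_on G S * det_on G T"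
proof -
  obtain xs ys where xs: "distinct xs" "set xs = S" and ys: "distinct ys" "set ys = T"
    using assms(1,2) finite_distinct_list by metis
  let ?m = "length xs" and ?n = "length ys"
  let ?C = "mat ?n ?m (\<lambda>(i, j). if ys ! i \<rightarrow>\<^bsub>G\<^esub> xs ! j then 1 else 0)"
  have "adjacency_matrix G (xs @ ys) =
      four_block_mat (adjacency_matrix G xs) (0\<^sub>m ?m ?n) ?C (adjacency_matrix G ys)"
    using assms(4) xs(2) ys(2)
    by (intro eq_matI) (auto simp: adjacency_matrix_def nth_append)
  then have "Determinant.det (adjacency_matrix G (xs @ ys)) =
      Determinant.det (adjacency_matrix G xs) * Determinant.det (adjacency_matrix G ys)"
    by (simp add: det_four_block_mat_upper_right_zero[OF adjacency_matrix_carrier refl _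
          adjacency_matrix_carrier])
  moreover have "det_on G (S \<union> T) = Determinant.det (adjacency_matrix G (xs @ ys))"
    using xs ys assms(3) by (intro det_on_eq) auto
  ultimately show ?thesis
    using det_on_eq[OF xs, of G] det_on_eq[OF ys, of G] by simp
qed

text \<open>Linearity of the determinant in the row of \<open>v\<close>: the three digraphs agree in
  all other rows, and the row in \<open>G\<close> is the sum of those in \<open>H\<close> and
  \<open>K\<close>.\<close>

lemma det_on_split_row:
  fixes G H K :: "('a, 'b) pre_digraph"
  assumes "finite S" "v \<notin> S"
    and row: "\<And>b. b \<in> insert v S \<Longrightarrow> v \<rightarrow>\<^bsub>G\<^esub> b \<longleftrightarrow> v \<rightarrow>\<^bsub>H\<^esub> b \<or> v \<rightarrow>\<^bsub>K\<^esub> b"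
      "\<And>b. b \<in> insert v S \<Longrightarrow> \<not> (v \<rightarrow>\<^bsub>H\<^esub> b \<and> v \<rightarrow>\<^bsub>K\<^esub> b)"
    and rest: "\<And>a b. a \<in> S \<Longrightarrow> b \<in> insert v S \<Longrightarrow> a \<rightarrow>\<^bsub>H\<^esub> b \<longleftrightarrow> a \<rightarrow>\<^bsub>G\<^esub> b"
      "\<And>a b. a \<in> S \<Longrightarrow> b \<in> insert v S \<Longrightarrow> a \<rightarrow>\<^bsub>K\<^esub> b \<longleftrightarrow> a \<rightarrow>\<^bsub>G\<^esub> b"
  shows "det_on G (insert v S) = det_on H (insert v S) + det_on K (insert v S)"
proof -
  obtain xs where xs: "distinct xs" "set xs = S"
    using assms(1) finite_distinct_list by metis
  let ?vs = "v # xs"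
  let ?n = "length ?vs"
  have mem: "?vs ! j \<in> insert v S" if "j < ?n" for j
    using nth_mem[OF that] xs(2) by simp
  \<comment> \<open>Row 0 belongs to \<open>v\<close>; once it is deleted only rows of
    \<open>S\<close> remain.\<close>
  have cof: "cofactor (adjacency_matrix L ?vs) 0 j = cofactor (adjacency_matrix G ?vs) 0 j"
    if "\<And>a b. a \<in> S \<Longrightarrow> b \<in> insert v S \<Longrightarrow> a \<rightarrow>\<^bsub>L\<^esub> b \<longleftrightarrow> a \<rightarrow>\<^bsub>G\<^esub> b" "j < ?n"
    for L :: "('a, 'b) pre_digraph" and j
  proof -
    have "mat_delete (adjacency_matrix L ?vs) 0 j = mat_delete (adjacency_matrix G ?vs) 0 j"
      using that(1) mem xs(2) nth_mem[of _ xs]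
      by (intro eq_matI) (auto simp: mat_delete_def adjacency_matrix_def simp del: nth_Cons_Suc)
    then show ?thesis by (simp add: Determinant.cofactor_def)
  qed
  have lap: "Determinant.det (adjacency_matrix L ?vs) =
      (\<Sum>j<?n. (if v \<rightarrow>\<^bsub>L\<^esub> ?vs ! j then 1 else 0) * cofactor (adjacency_matrix L ?vs) 0 j)"
    for L :: "('a, 'b) pre_digraph"
    by (subst laplace_expansion_row[OF adjacency_matrix_carrier, of 0])
      (auto simp: adjacency_matrix_def intro!: sum.cong)
  let ?c = "cofactor (adjacency_matrix G ?vs) 0"
  have "Determinant.det (adjacency_matrix G ?vs) =
      (\<Sum>j<?n. (if v \<rightarrow>\<^bsub>H\<^esub> ?vs ! j then 1 else 0) * ?c j +
        (if v \<rightarrow>\<^bsub>K\<^esub> ?vs ! j then 1 else 0) * ?c j)"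
    unfolding lap[of G] using row mem by (intro sum.cong) auto
  also have "\<dots> = Determinant.det (adjacency_matrix H ?vs) + Determinant.det (adjacency_matrix K ?vs)"
    unfolding lap[of H] lap[of K] sum.distrib using cof[OF rest(1)] cof[OF rest(2)] by simp
  finally show ?thesis
    using xs assms(2) by (simp add: det_on_eq[of ?vs "insert v S"])
qed

text \<open>The row of \<open>v\<close> splits into its arcs to \<open>S\<close> and its arcs to
  \<open>T\<close>. In the first summand \<open>v\<close> belongs with \<open>S\<close>, in the
  second with \<open>T\<close>, and each matrix is block triangular.\<close>

lemma det_on_glue:
  fixes G :: "('a, 'b) pre_digraph"
  assumes fin: "finite S" "finite T" and v: "v \<notin> S" "v \<notin> T" "\<not> v \<rightarrow>\<^bsub>G\<^esub> v"
    and disj: "S \<inter> T = {}"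
    and no_arcs: "\<And>a b. a \<in> S \<Longrightarrow> b \<in> T \<Longrightarrow> \<not> a \<rightarrow>\<^bsub>G\<^esub> b"
      "\<And>a b. a \<in> S \<Longrightarrow> b \<in> T \<Longrightarrow> \<not> b \<rightarrow>\<^bsub>G\<^esub> a"
  shows "det_on G (insert v (S \<union> T)) =
    det_on G (insert v S) * det_on G T + det_on G S * det_on G (insert v T)"
proof -
  \<comment> \<open>Removing the arcs from \<open>v\<close> into \<open>X\<close> changes row
    \<open>v\<close> only. As \<open>v\<close> has no loop, each of its arcs within the glued vertex
    set survives in exactly one of \<open>cut S\<close> and \<open>cut T\<close>.\<close>
  define cut where
    "cut X = G\<lparr>arcs := {e \<in> arcs G. \<not> (tail G e = v \<and> head G e \<in> X)}\<rparr>" for X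
  have cut: "a \<rightarrow>\<^bsub>cut X\<^esub> b \<longleftrightarrow> a \<rightarrow>\<^bsub>G\<^esub> b \<and> \<not> (a = v \<and> b \<in> X)" for a b X
    by (auto simp: cut_def arcs_ends_conv)
  have "det_on G (insert v (S \<union> T)) =
      det_on (cut T) (insert v (S \<union> T)) + det_on (cut S) (insert v (S \<union> T))"
    using assms by (intro det_on_split_row) (auto simp: cut)
  also have "insert v (S \<union> T) = insert v S \<union> T" by auto
  also have "det_on (cut T) (insert v S \<union> T) = det_on (cut T) (insert v S) * det_on (cut T) T"
    using assms by (intro det_on_Un) (auto simp: cut)
  also have "det_on (cut T) (insert v S) = det_on G (insert v S)"
    using assms by (intro det_on_cong) (auto simp: cut)
  also have "det_on (cut T) T = det_on G T"
    using assms by (intro det_on_cong) (auto simp: cut)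
  also have "insert v S \<union> T = insert v T \<union> S" by auto
  also have "det_on (cut S) (insert v T \<union> S) = det_on (cut S) (insert v T) * det_on (cut S) S"
    using assms by (intro det_on_Un) (auto simp: cut)
  also have "det_on (cut S) (insert v T) = det_on G (insert v T)"
    using assms by (intro det_on_cong) (auto simp: cut)
  also have "det_on (cut S) S = det_on G S"
    using assms by (intro det_on_cong) (auto simp: cut)
  finally show ?thesis by (simp add: mult.commute Un_commute)
qed

lemma det_on_UN:
  assumes "finite I" "\<And>i. i \<in> I \<Longrightarrow> finite (S i)"
    and "\<And>i j. i \<in> I \<Longrightarrow> j \<in> I \<Longrightarrow> i \<noteq> j \<Longrightarrow> S i \<inter> S j = {}"
    and "\<And>i j a b. i \<in> I \<Longrightarrow> j \<in> I \<Longrightarrow> i \<noteq> j \<Longrightarrow> a \<in> S i \<Longrightarrow> b \<in> S j \<Longrightarrow> \<not> a \<rightarrow>\<^bsub>G\<^esub> b"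
  shows "det_on G (\<Union>i\<in>I. S i) = (\<Prod>i\<in>I. det_on G (S i))"
  using assms
proof (induction I rule: finite_induct)
  case (insert i I)
  have "det_on G (S i \<union> (\<Union>j\<in>I. S j)) = det_on G (S i) * det_on G (\<Union>j\<in>I. S j)"
  proof (rule det_on_Un)
    show "S i \<inter> (\<Union>j\<in>I. S j) = {}" using insert.hyps insert.prems(2) by blast
    show "\<not> a \<rightarrow>\<^bsub>G\<^esub> b" if "a \<in> S i" "b \<in> (\<Union>j\<in>I. S j)" for a b
      using that insert.hyps insert.prems(3) by blast
  qed (use insert.hyps insert.prems(1) in auto)
  also have "det_on G (\<Union>j\<in>I. S j) = (\<Prod>j\<in>I. det_on G (S j))"
    using insert.prems by (intro insert.IH) blast+
  finally show ?case using insert.hyps by simp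
qed (simp add: det_on_empty)

text \<open>Gluing one set at a time gives a Leibniz rule, in which adding \<open>v\<close> plays
  the part of the derivation. The empty family contributes 0 because \<open>v\<close> has no
  loop.\<close>

lemma det_on_star:
  assumes "finite I" "\<not> v \<rightarrow>\<^bsub>G\<^esub> v" "\<And>i. i \<in> I \<Longrightarrow> finite (S i)" "\<And>i. i \<in> I \<Longrightarrow> v \<notin> S i"
    and "\<And>i j. i \<in> I \<Longrightarrow> j \<in> I \<Longrightarrow> i \<noteq> j \<Longrightarrow> S i \<inter> S j = {}"
    and "\<And>i j a b. i \<in> I \<Longrightarrow> j \<in> I \<Longrightarrow> i \<noteq> j \<Longrightarrow> a \<in> S i \<Longrightarrow> b \<in> S j \<Longrightarrow> \<not> a \<rightarrow>\<^bsub>G\<^esub> b"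
  shows "det_on G (insert v (\<Union>i\<in>I. S i)) =
    (\<Sum>i\<in>I. det_on G (insert v (S i)) * (\<Prod>j\<in>I - {i}. det_on G (S j)))"
  using assms(1,3-)
proof (induction I rule: finite_induct)
  case (insert i I)
  let ?d = "\<lambda>i. det_on G (insert v (S i))" and ?e = "\<lambda>i. det_on G (S i)"
  have "det_on G (insert v (S i \<union> (\<Union>j\<in>I. S j))) =
      ?d i * det_on G (\<Union>j\<in>I. S j) + ?e i * det_on G (insert v (\<Union>j\<in>I. S j))"
  proof (rule det_on_glue)
    show "S i \<inter> (\<Union>j\<in>I. S j) = {}" using insert.hyps insert.prems(3) by blast
    show "\<not> a \<rightarrow>\<^bsub>G\<^esub> b" "\<not> b \<rightarrow>\<^bsub>G\<^esub> a" if "a \<in> S i" "b \<in> (\<Union>j\<in>I. S j)" for a b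
      using that insert.hyps insert.prems(4) by blast+
  qed (use assms(2) insert.hyps insert.prems(1,2) in auto)
  also have "det_on G (\<Union>j\<in>I. S j) = (\<Prod>j\<in>I. ?e j)"
  proof (rule det_on_UN)
    show "\<not> a \<rightarrow>\<^bsub>G\<^esub> b" if "j \<in> I" "l \<in> I" "j \<noteq> l" "a \<in> S j" "b \<in> S l" for j l a b
      using that insert.prems(4)[of j l a b] by simp
  qed (use insert.hyps(1) insert.prems(1,3) in simp_all)
  also have "det_on G (insert v (\<Union>j\<in>I. S j)) = (\<Sum>k\<in>I. ?d k * (\<Prod>j\<in>I - {k}. ?e j))"
  proof (rule insert.IH)
    show "\<not> a \<rightarrow>\<^bsub>G\<^esub> b" if "j \<in> I" "l \<in> I" "j \<noteq> l" "a \<in> S j" "b \<in> S l" for j l a b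
      using that insert.prems(4)[of j l a b] by simp
  qed (use insert.prems(1-3) in simp_all)
  also have "?e i * \<dots> = (\<Sum>k\<in>I. ?d k * (\<Prod>j\<in>insert i I - {k}. ?e j))"
    unfolding sum_distrib_left
  proof (rule sum.cong)
    fix k assume "k \<in> I"
    then have "insert i I - {k} = insert i (I - {k})" using insert.hyps by auto
    then show "?e i * (?d k * (\<Prod>j\<in>I - {k}. ?e j)) = ?d k * (\<Prod>j\<in>insert i I - {k}. ?e j)"
      using insert.hyps by simp
  qed simp
  finally show ?case using insert.hyps by simp
qed (use assms(2) in \<open>simp add: det_on_single\<close>)

section \<open>Mixed complete graphs\<close>

lemma sum_even_indicator: "(\<Sum>k<m. if even k then 1 else 0 :: int) = (int m + 1) div 2"
  by (induction m) (auto elim!: evenE oddE)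

text \<open>The vector \<open>(1, 0, 1, 0, \<dots>)\<close> is mapped to a multiple of the all-ones vector, and
  subtracting the latter from the remaining columns leaves a triangular matrix.\<close>

lemma det_path_complement:
  assumes "m > 0"
  shows "Determinant.det (mat m m (\<lambda>(i, j). if i = j \<or> i = Suc j then 0 else 1)) =
    (-1) ^ (m - 1) * ((int m + 1) div 2 - 1)"
proof -
  let ?s = "(int m + 1) div 2 - 1"
  define x where "x k = (if even k then 1 else 0 :: int)" for k :: nat
  define E where "E = mat m m (\<lambda>(i, j). if i = j \<or> i = Suc j then 0 else 1 :: int)"
  \<comment> \<open>\<open>R\<close> is the identity with first column replaced by \<open>x\<close>;
    since \<open>x 0 = 1\<close> it is unitriangular.\<close>
  define R where "R = mat m m (\<lambda>(i, j). if j = 0 then x i else if i = j then 1 else 0)"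
  \<comment> \<open>Away from column 0, \<open>L\<close> is \<open>E\<close> minus the all-ones
    matrix. Its column 0 is all ones, and the first row of \<open>U\<close> adds that column back
    or, in column 0, scales it by \<open>?s\<close>.\<close>
  define L where
    "L = mat m m (\<lambda>(i, j). if j = 0 then 1 else if i = j \<or> i = Suc j then - 1 else 0 :: int)"
  define U where
    "U = mat m m (\<lambda>(i, j). if i = 0 then (if j = 0 then ?s else 1) else if i = j then 1 else 0)"
  have carrier: "E \<in> carrier_mat m m" "R \<in> carrier_mat m m" "L \<in> carrier_mat m m" "U \<in> carrier_mat m m"
    by (simp_all add: E_def R_def L_def U_def)
  have "E * R = L * U"
  proof (rule eq_matI)
    fix i j assume "i < dim_row (L * U)" "j < dim_col (L * U)"
    then have ij: "i < m" "j < m" by (simp_all add: L_def U_def)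
    have ER: "(E * R) $$ (i, j) = (\<Sum>k<m. E $$ (i, k) * R $$ (k, j))"
      using ij carrier by (simp add: scalar_prod_def lessThan_atLeast0)
    have LU: "(L * U) $$ (i, j) = (\<Sum>k<m. L $$ (i, k) * U $$ (k, j))"
      using ij carrier by (simp add: scalar_prod_def lessThan_atLeast0)
    show "(E * R) $$ (i, j) = (L * U) $$ (i, j)"
    proof (cases "j = 0")
      case True
      have "(E * R) $$ (i, j) = (\<Sum>k<m. x k - (if k = i then x k else 0) - (if Suc k = i then x k else 0))"
        unfolding ER using ij True by (intro sum.cong) (auto simp: E_def R_def)
      also have "\<dots> = (\<Sum>k<m. x k) - x i - (if i = 0 then 0 else x (i - 1))"
        using ij by (cases i) (simp_all add: sum_subtractf)
      \<comment> \<open>Of two consecutive entries of \<open>x\<close> exactly one is 1, and row 0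
        loses only \<open>x 0 = 1\<close>; so each row loses one of the ones counted by
        \<open>(int m + 1) div 2\<close>.\<close>
      also have "\<dots> = ?s"
        using sum_even_indicator[of m] by (cases i) (auto simp: x_def)
      also have "\<dots> = (\<Sum>k<m. if k = 0 then ?s else 0)"
        using assms by simp
      also have "\<dots> = (L * U) $$ (i, j)"
        unfolding LU using ij True by (intro sum.cong) (auto simp: L_def U_def)
      finally show ?thesis .
    next
      case False
      have "(E * R) $$ (i, j) = (\<Sum>k<m. if k = j then E $$ (i, j) else 0)"
        unfolding ER using ij False by (intro sum.cong) (auto simp: R_def)
      also have "\<dots> = E $$ (i, j)" using ij by simp
      also have "\<dots> = 1 + L $$ (i, j)" using ij False by (simp add: E_def L_def)
      also have "\<dots> = (\<Sum>k<m. (if k = 0 then 1 else 0) + (if k = j then L $$ (i, j) else 0))"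
        using ij assms by (simp add: sum.distrib)
      also have "\<dots> = (L * U) $$ (i, j)"
        unfolding LU using ij False by (intro sum.cong) (auto simp: L_def U_def)
      finally show ?thesis .
    qed
  qed (simp_all add: E_def R_def L_def U_def)
  then have "Determinant.det E * Determinant.det R = Determinant.det L * Determinant.det U"
    using det_mult[OF carrier(1,2)] det_mult[OF carrier(3,4)] by simp
  moreover have "Determinant.det R = 1"
    using det_lower_triangular[OF _ carrier(2)]
    by (auto simp: prod_list_diag_prod R_def x_def intro!: prod.neutral)
  \<comment> \<open>Index 0 is split off because the diagonals are \<open>1, -1, -1, ...\<close> for
    \<open>L\<close> and \<open>?s, 1, 1, ...\<close> for \<open>U\<close>.\<close>
  moreover have "{0..<m} = insert 0 {1..<m}" using assms by auto
  then have "Determinant.det L = (-1) ^ (m - 1)" "Determinant.det U = ?s"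
    using det_lower_triangular[OF _ carrier(3)] det_upper_triangular[OF _ carrier(4)]
      assms
    by (auto simp: prod_list_diag_prod L_def U_def upper_triangular_def)
  ultimately show ?thesis by (simp add: E_def)
qed

section \<open>Arcs and cyclic symmetry of the mixed complete graph\<close>

text \<open>Apart from loops, the only missing arcs are the reversals of the cycle arcs, and
  \<open>q mod n + 1\<close> is the cyclic successor of \<open>q\<close>.\<close>

lemma mK_dominates_iff:
  assumes "n > 3"
  shows "p \<rightarrow>\<^bsub>with_proj (mK n)\<^esub> q \<longleftrightarrow>
    p \<in> {1..n} \<and> q \<in> {1..n} \<and> p \<noteq> q \<and> p \<noteq> q mod n + 1"
proof -
  have dC: "(p, q) \<in> parcs (dC n) \<longleftrightarrow> p \<in> {1..n} \<and> q = p mod n + 1" for p q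
    using assms by (cases "p = n") (auto simp: dC_def)
  have "p mod n + 1 \<in> {1..n}" "p \<noteq> p mod n + 1" "p \<noteq> (p mod n + 1) mod n + 1"
    if p: "p \<in> {1..n}" for p
  proof -
    show "p mod n + 1 \<in> {1..n}" using assms by (simp add: Suc_leI)
    \<comment> \<open>The successor wraps around in the first case, the second successor in the
      first two.\<close>
    consider "p = n" | "p = n - 1" | "p < n - 1"
      using p by atomize_elim auto
    then have "p \<noteq> p mod n + 1 \<and> p \<noteq> (p mod n + 1) mod n + 1"
      using assms by cases auto
    then show "p \<noteq> p mod n + 1" "p \<noteq> (p mod n + 1) mod n + 1" by simp_all
  qed
  moreover have "p \<rightarrow>\<^bsub>with_proj (mK n)\<^esub> q \<longleftrightarrow> (p, q) \<in> parcs (dC n) \<or>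
      p \<in> {1..n} \<and> q \<in> {1..n} \<and> p \<noteq> q \<and> (p, q) \<notin> parcs (dC n) \<and> (q, p) \<notin> parcs (dC n)"
    by (simp add: mK_def) (simp add: dC_def)
  ultimately show ?thesis
    unfolding dC by metis
qed

text \<open>Numbering the vertices along the cycle gives the same matrix from every starting point,
  so the deleted vertex may later be placed last.\<close>

lemma mK_rotation_dominates_iff:
  assumes "n > 3" "i < n" "j < n"
  shows "((c + i) mod n + 1) \<rightarrow>\<^bsub>with_proj (mK n)\<^esub> ((c + j) mod n + 1) \<longleftrightarrow>
    i \<noteq> j \<and> i \<noteq> Suc j mod n"
proof -
  have cancel: "(c + a) mod n = (c + b) mod n \<longleftrightarrow> a mod n = b mod n" for a b
    using cong_add_lcancel_nat[of c a b n] by (simp add: cong_def)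
  have "((c + j) mod n + 1) mod n = (c + Suc j) mod n"
    by (simp add: mod_simps)
  then show ?thesis
    unfolding mK_dominates_iff[OF assms(1)] using cancel[of i j] cancel[of i "Suc j"] assms
    by (auto simp: Suc_le_eq)
qed

lemma det_on_mK_delete_vertex:
  assumes "n > 3" "w \<in> {1..n}"
  shows "det_on (with_proj (mK n)) ({1..n} - {w}) = (-1) ^ n * (int n div 2 - 1)"
proof -
  \<comment> \<open>The cycle is traversed from the successor of \<open>w\<close>, reaching
    \<open>w\<close> itself at \<open>k = n - 1\<close>. Without that index no pair wraps around,
    and the condition modulo \<open>n\<close> becomes \<open>i = Suc j\<close>.\<close>
  let ?f = "\<lambda>k. (w + k) mod n + 1"
  let ?vs = "map ?f [0..<n - 1]"
  have cancel: "(w + a) mod n = (w + b) mod n \<longleftrightarrow> a = b" if "a < n" "b < n" for a b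
    using cong_add_lcancel_nat[of w a b n] that by (simp add: cong_def)
  have inj: "inj_on ?f {0..<n - 1}"
    using cancel by (auto simp: inj_on_def)
  have last: "?f (n - 1) = w"
  proof -
    have "w + (n - 1) = (w - 1) + n" using assms by auto
    then have "?f (n - 1) = (w - 1) mod n + 1" by simp
    also have "w - 1 < n" using assms by auto
    then have "(w - 1) mod n + 1 = w" using assms by simp
    finally show ?thesis .
  qed
  have "?f ` {0..<n - 1} \<subseteq> {1..n} - {w}"
  proof
    fix u assume "u \<in> ?f ` {0..<n - 1}"
    then obtain a where a: "a < n - 1" "u = ?f a" by auto
    then have "?f a \<noteq> ?f (n - 1)" using cancel[of a "n - 1"] by simp
    then show "u \<in> {1..n} - {w}" using last a assms(1) by (auto simp: Suc_le_eq)
  qed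
  moreover have "card (?f ` {0..<n - 1}) = card ({1..n} - {w})"
    unfolding card_image[OF inj] using assms(2) by simp
  ultimately have set: "?f ` {0..<n - 1} = {1..n} - {w}"
    by (intro card_subset_eq) auto
  have "det_on (with_proj (mK n)) ({1..n} - {w}) =
      Determinant.det (adjacency_matrix (with_proj (mK n)) ?vs)"
    using inj set by (intro det_on_eq) (auto simp: distinct_map)
  also have "adjacency_matrix (with_proj (mK n)) ?vs =
      mat (n - 1) (n - 1) (\<lambda>(i, j). if i = j \<or> i = Suc j then 0 else 1)"
    using mK_rotation_dominates_iff[OF assms(1), of _ _ w]
    by (intro eq_matI) (auto simp: adjacency_matrix_def)
  also have "Determinant.det \<dots> = (-1) ^ (n - 1 - 1) * ((int (n - 1) + 1) div 2 - 1)"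
    using assms(1) by (intro det_path_complement) simp
  also have "(-1) ^ (n - 1 - 1) = ((-1) ^ n :: int)"
    using assms(1) by (simp add: minus_one_power_iff)
  also have "int (n - 1) + 1 = int n" using assms(1) by simp
  finally show ?thesis .
qed

section \<open>Singularity in even order\<close>

lemma sum_alternating: "even n \<Longrightarrow> (\<Sum>j<n. (-1) ^ j :: int) = 0"
  by (induction n rule: induct_nat_012) auto

lemma digraph_det_mK_even:
  assumes "n > 3" "even n"
  shows "digraph_det (with_proj (mK n)) = 0"
proof -
  let ?A = "adjacency_matrix (with_proj (mK n)) (map Suc [0..<n])"
  let ?x = "vec n (\<lambda>j. (-1) ^ j :: int)"
  have A: "?A \<in> carrier_mat n n"
    using adjacency_matrix_carrier[of _ "map Suc [0..<n]"] by simp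
  have entry: "?A $$ (i, j) = (if i = j \<or> i = Suc j mod n then 0 else 1)" if "i < n" "j < n" for i j
    using mK_rotation_dominates_iff[OF assms(1) that, of 0] that
    by (simp add: adjacency_matrix_def)
  have "?A *\<^sub>v ?x = 0\<^sub>v n"
  proof (rule eq_vecI)
    fix i assume "i < dim_vec (0\<^sub>v n :: int vec)"
    then have i: "i < n" by simp
    \<comment> \<open>The cyclic predecessor of \<open>i\<close>: row \<open>i\<close> vanishes
      exactly at the columns \<open>i\<close> and \<open>h\<close>.\<close>
    define h where "h = (if i = 0 then n - 1 else i - 1)"
    have h: "h < n" "h \<noteq> i" "i = Suc j mod n \<longleftrightarrow> j = h" if "j < n" for j
      using i that assms(1) by (cases "Suc j = n"; auto simp: h_def)+
    have "(?A *\<^sub>v ?x) $ i = (\<Sum>j<n. ?A $$ (i, j) * (-1) ^ j)"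
      using A i by (simp add: scalar_prod_def lessThan_atLeast0)
    also have "\<dots> = (\<Sum>j<n. (-1) ^ j - (if j = i then (-1) ^ j else 0) - (if j = h then (-1) ^ j else 0))"
      using i h by (intro sum.cong) (auto simp: entry)
    also have "\<dots> = - ((-1) ^ i) - (-1) ^ h"
      using i h(1)[OF i] sum_alternating[OF assms(2)] by (simp add: sum_subtractf)
    \<comment> \<open>\<open>i\<close> and \<open>h\<close> have opposite parity; for
      \<open>i = 0\<close> this uses that \<open>n - 1\<close> is odd.\<close>
    also have "\<dots> = 0"
      using i assms by (cases i) (auto simp: h_def minus_one_power_iff)
    finally show "(?A *\<^sub>v ?x) $ i = 0\<^sub>v n $ i" using i by simp
  qed (use A in simp)
  moreover have "?x \<noteq> 0\<^sub>v n"
    using assms(1) by (auto dest!: arg_cong[where f = "\<lambda>x. x $ 0"])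
  ultimately have "Determinant.det ?A = 0"
    using det_0_iff_vec_prod_zero[OF A] vec_carrier by blast
  moreover have "set (map Suc [0..<n]) = verts (with_proj (mK n))"
    by (simp add: mK_def dC_def image_Suc_atLeastLessThan atLeastLessThanSuc_atLeastAtMost)
  ultimately show ?thesis
    using digraph_det_eq[of "map Suc [0..<n]" "with_proj (mK n)"] by (simp add: distinct_map)
qed

section \<open>Mixed star block graphs\<close>

text \<open>Reduces an isomorphism of vertices and arcs to a vertex bijection that respects
  adjacency in \<open>G\<close> itself, as needed to transport minors.\<close>

lemma (in digraph) block_iso_mK:
  assumes "C \<in> blocks G" "digraph_iso C (with_proj (mK m))" "m > 3"
  obtains f where "inj_on f (verts C)" "f ` verts C = {1..m}"
    "\<And>a b. a \<in> verts C \<Longrightarrow> b \<in> verts C \<Longrightarrow> a \<rightarrow>\<^bsub>G\<^esub> b \<longleftrightarrow> f a \<rightarrow>\<^bsub>with_proj (mK m)\<^esub> f b"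
proof -
  interpret C: wf_digraph C using assms(1) by (auto simp: blocks_def max_subgraph_def)
  obtain h where h: "C.digraph_isomorphism h" and mK: "with_proj (mK m) = app_iso h C"
    using assms(2) by (auto simp: digraph_iso_def)
  let ?f = "iso_verts h"
  have inj: "inj_on ?f (verts C)"
    using h by (simp add: C.digraph_isomorphism_def)
  have "verts (with_proj (mK m)) = {1..m}"
    by (simp add: mK_def dC_def)
  then have img: "?f ` verts C = {1..m}"
    unfolding mK by simp
  have dom: "a \<rightarrow>\<^bsub>G\<^esub> b \<longleftrightarrow> ?f a \<rightarrow>\<^bsub>with_proj (mK m)\<^esub> ?f b" if ab: "a \<in> verts C" "b \<in> verts C" for a b
  proof (cases "a = b")
    \<comment> \<open>Neither side has loops; the comparison of arcs in a block and in
      \<open>G\<close> covers distinct vertices only.\<close>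
    case True
    then show ?thesis
      using adj_not_same mK_dominates_iff[OF assms(3)] by auto
  next
    case False
    have "a = u \<and> b = w" if "u \<rightarrow>\<^bsub>C\<^esub> w" "?f a = ?f u" "?f b = ?f w" for u w
      using inj ab that C.adj_in_verts[OF that(1)] by (simp add: inj_on_eq_iff)
    then have "?f a \<rightarrow>\<^bsub>app_iso h C\<^esub> ?f b \<longleftrightarrow> a \<rightarrow>\<^bsub>C\<^esub> b"
      unfolding C.arcs_ends_app_iso_eq[OF h] by force
    then show ?thesis
      using block_dominates_iff[OF assms(1) ab False] mK by simp
  qed
  show ?thesis using that inj img dom by blast
qed

theorem theorem12:
  fixes G :: "('a, 'b) pre_digraph"
    and B :: "nat \<Rightarrow> ('a, 'b) pre_digraph"
    and n :: "nat \<Rightarrow> nat"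
    and k :: nat
  assumes "mixed_star_block_graph G"
    and "bij_betw B {1..k} (blocks G)"
    and "\<And>i. i \<in> {1..k} \<Longrightarrow> n i = card (verts (B i))"
  shows "digraph_det G =
    (\<Sum>i | i \<in> {1..k} \<and> odd (n i).
       digraph_det (with_proj (mK (n i))) *
       (\<Prod>j \<in> {1..k} - {i}. (-1) ^ n j * \<lfloor>(real (n j) - 2) / 2\<rfloor>))"
proof -
  interpret digraph G using assms(1) by (simp add: mixed_star_block_graph_def)
  obtain v where v: "v \<in> verts G" "\<And>C. C \<in> blocks G \<Longrightarrow> v \<in> verts C"
    using assms(1) by (rule mixed_star_block_graph_center) blast
  let ?I = "{1..k}"
  define S where "S i = verts (B i) - {v}" for i
  have img: "B ` ?I = blocks G"
    using assms(2) by (rule bij_betw_imp_surj_on)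
  have block: "B i \<in> blocks G" if "i \<in> ?I" for i
    using that img by blast
  have sub: "subgraph (B i) G" if "i \<in> ?I" for i
    using block[OF that] by (auto simp: blocks_def max_subgraph_def)
  have fin: "finite (verts (B i))" if "i \<in> ?I" for i
    using fin_digraph_subgraph[OF sub[OF that]] by (rule fin_digraph.finite_verts)
  \<comment> \<open>Such an \<open>a\<close> and the center \<open>v\<close> are two common vertices
    of the blocks.\<close>
  have same: "i = j" if "i \<in> ?I" "j \<in> ?I" "a \<in> verts (B i)" "a \<in> S j" for i j a
  proof -
    have "a \<noteq> v" "a \<in> verts (B j)" using that by (auto simp: S_def)
    then have "B i = B j"
      using blocks_eq_if_share_two_vertices[of "B i" "B j" v a] that v(2) block by auto
    then show ?thesis
      using that(1,2) bij_betw_imp_inj_on[OF assms(2)] by (simp add: inj_on_eq_iff)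
  qed
  \<comment> \<open>The block containing the arc would meet both \<open>B i\<close> and
    \<open>B j\<close> off the center, hence equal both.\<close>
  have no_arc: "\<not> a \<rightarrow>\<^bsub>G\<^esub> b" if ij: "i \<in> ?I" "j \<in> ?I" "i \<noteq> j" and ab: "a \<in> S i" "b \<in> S j" for i j a b
  proof
    assume arc: "a \<rightarrow>\<^bsub>G\<^esub> b"
    then have "a \<noteq> b" using adj_not_same by auto
    with arc obtain C where C: "C \<in> blocks G" "a \<rightarrow>\<^bsub>C\<^esub> b" by (rule arc_in_block)
    then obtain l where l: "l \<in> ?I" "B l = C"
      using img by (metis imageE)
    have "wf_digraph (B l)" using sub[OF l(1)] by auto
    then have "a \<in> verts (B l)" "b \<in> verts (B l)"
      using C l by (auto dest: wf_digraph.adj_in_verts)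
    then have "l = i" "l = j" using same l ij ab by blast+
    then show False using ij by simp
  qed
  have verts_G: "verts G = insert v (\<Union>i\<in>?I. S i)"
  proof
    show "verts G \<subseteq> insert v (\<Union>i\<in>?I. S i)"
    proof
      fix w assume "w \<in> verts G"
      then obtain C where C: "C \<in> blocks G" "w \<in> verts C" by (rule vertex_in_block)
      then obtain i where "i \<in> ?I" "B i = C"
        using img by (metis imageE)
      then show "w \<in> insert v (\<Union>i\<in>?I. S i)" using C by (auto simp: S_def)
    qed
    show "insert v (\<Union>i\<in>?I. S i) \<subseteq> verts G"
      using v(1) sub by (fastforce simp: S_def subgraph_def)
  qed
  have block_det: "n i > 3 \<and> det_on G (insert v (S i)) = digraph_det (with_proj (mK (n i))) \<and>
      det_on G (S i) = (-1) ^ n i * \<lfloor>(real (n i) - 2) / 2\<rfloor>" if i: "i \<in> ?I" for i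
  proof -
    obtain m where m: "m > 3" and iso: "digraph_iso (B i) (with_proj (mK m))"
      using assms(1) block[OF i] by (auto simp: mixed_star_block_graph_def)
    obtain f where f: "inj_on f (verts (B i))" "f ` verts (B i) = {1..m}"
      "\<And>a b. a \<in> verts (B i) \<Longrightarrow> b \<in> verts (B i) \<Longrightarrow> a \<rightarrow>\<^bsub>G\<^esub> b \<longleftrightarrow> f a \<rightarrow>\<^bsub>with_proj (mK m)\<^esub> f b"
      using block_iso_mK[OF block[OF i] iso m] by blast
    \<comment> \<open>The order provided by the isomorphism is recovered by counting
      vertices.\<close>
    have "n i = m"
      using assms(3)[OF i] card_image[OF f(1)] f(2) by simp
    have vB: "v \<in> verts (B i)" using v(2) block[OF i] by simp
    have "det_on G (verts (B i)) = det_on (with_proj (mK m)) {1..m}"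
      using det_on_image[OF fin[OF i] f(1) f(3)] f(2) by simp
    moreover have "insert v (S i) = verts (B i)" using vB by (auto simp: S_def)
    moreover have "verts (with_proj (mK m)) = {1..m}"
      by (simp add: mK_def dC_def)
    moreover have "f ` S i = {1..m} - {f v}"
      using f(1,2) vB inj_on_image_set_diff[of f "verts (B i)" "verts (B i)" "{v}"]
      by (simp add: S_def)
    then have "det_on G (S i) = det_on (with_proj (mK m)) ({1..m} - {f v})"
      using det_on_image[of "S i" f G "with_proj (mK m)"] fin[OF i] f(1,3)
      by (auto simp: S_def inj_on_diff)
    moreover have "f v \<in> {1..m}" using f(2) vB by blast
    moreover have "\<lfloor>(real m - 2) / 2\<rfloor> = int m div 2 - 1"
    proof -
      have "\<lfloor>(real m - 2) / 2\<rfloor> = \<lfloor>real_of_int (int m - 2) / real_of_int 2\<rfloor>" by simp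
      also have "\<dots> = (int m - 2) div 2" by (rule floor_divide_of_int_eq)
      finally show ?thesis by simp
    qed
    ultimately show ?thesis
      using m \<open>n i = m\<close> det_on_mK_delete_vertex[OF m, of "f v"]
      by (simp add: digraph_det_eq_det_on)
  qed
  have "digraph_det G =
      (\<Sum>i\<in>?I. det_on G (insert v (S i)) * (\<Prod>j\<in>?I - {i}. det_on G (S j)))"
    unfolding digraph_det_eq_det_on verts_G
  proof (rule det_on_star)
    show "\<not> v \<rightarrow>\<^bsub>G\<^esub> v" using adj_not_same by auto
    show "S i \<inter> S j = {}" if "i \<in> ?I" "j \<in> ?I" "i \<noteq> j" for i j
      using same[of i j] that by (auto simp: S_def)
  qed (use fin no_arc in \<open>auto simp: S_def\<close>)
  also have "\<dots> = (\<Sum>i\<in>?I. digraph_det (with_proj (mK (n i))) *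
      (\<Prod>j \<in> ?I - {i}. (-1) ^ n j * \<lfloor>(real (n j) - 2) / 2\<rfloor>))"
    using block_det by (intro sum.cong refl arg_cong2[where f = "(*)"] prod.cong) auto
  \<comment> \<open>Blocks of even order are singular, so their summands vanish.\<close>
  also have "\<dots> = (\<Sum>i | i \<in> ?I \<and> odd (n i). digraph_det (with_proj (mK (n i))) *
      (\<Prod>j \<in> ?I - {i}. (-1) ^ n j * \<lfloor>(real (n j) - 2) / 2\<rfloor>))"
    using block_det digraph_det_mK_even by (intro sum.mono_neutral_right) auto
  finally show ?thesis .
qed

end
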